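(* Let $\mathcal{K}$ be a finite oriented simplicial complex of dimension $K$ with positive weights $w:\mathcal{K}\to(0,\infty)$, and let $0\le k\le K$. Let $D_k$ be the number of $k$-simplices of $\mathcal{K}$. Then the vector space $\mathbb{R}^{D_k}$ decomposes as the direct sum $$\mathbb{R}^{D_k}=\mathrm{Im}(\partial_k^\dagger)\oplus\mathrm{Ker}(L_k)\oplus\mathrm{Im}(\partial_{k+1}),$$ where $\partial_k^\dagger=B_k^T$, $\partial_{k+1}=W_k^{-1}B_{k+1}W_{k+1}$, and $L_k=B_k^TW_{k-1}^{-1}B_kW_k+W_k^{-1}B_{k+1}W_{k+1}B_{k+1}^T$ is the $k$-th weighted Hodge Laplacian. Consequently, every signal $s^k\in C_k(\mathcal{K},\mathbb{R})\cong\mathbb{R}^{D_k}$ can be written as $$s^k=B_k^Ts^{k-1}+s^k_H+W_k^{-1}B_{k+1}W_{k+1}s^{k+1}$$ for some $s^{k-1}\in\mathbb{R}^{D_{k-1}}$, $s^k_H\in\mathrm{Ker}(L_k)$ and $s^{k+1}\in\mathbb{R}^{D_{k+1}}$.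
   Context: A (finite abstract) simplicial complex $\mathcal{K}$ is a finite collection of finite nonempty vertex sets closed under taking nonempty subsets; a $k$-simplex is an element with $k+1$ vertices, and the dimension $K$ is the largest order $k$ of a simplex. Each simplex carries a fixed orientation (an ordering of its vertices up to even permutation; vertices have the trivial orientation). $C_k(\mathcal{K},\mathbb{R})\cong\mathbb{R}^{D_k}$ is the space of real linear combinations of oriented $k$-simplices. For $1\le k\le K$, the incidence matrix $B_k\in\mathbb{R}^{D_{k-1}\times D_k}$ is the matrix of the unweighted boundary operator $[v_{i_0},\dots,v_{i_k}]\mapsto\sum_{j=0}^k(-1)^j[v_{i_0},\dots,v_{i_k}]\setminus[v_{i_j}]$ in the bases of oriented simplices: its $(i,j)$ entry is $0$ if the $(k-1)$-simplex $\sigma_i^{k-1}$ is not a face of $\sigma_j^k$, and otherwise $1$ or $-1$ according to whether the orientations of $\sigma_i^{k-1}$ and $\sigma_j^k$ are coherent or not. One has $B_kB_{k+1}=0$. $W_k\in\mathbb{R}^{D_k\times D_k}$ is the diagonal matrix of the (positive) weights of the $k$-simplices. The matrix of the weighted boundary operator $\partial_k$ is $W_{k-1}^{-1}B_kW_k$ and that of $\partial_k^\dagger$ is $B_k^T$. Conventions: there are no simplices of order $-1$ or $K+1$, i.e. $D_{-1}=D_{K+1}=0$, so the terms involving $B_0$ and $B_{K+1}$ vanish. *)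

theory Defs
  imports
    "HOL-Combinatorics.Permutations"
    "Jordan_Normal_Form.Matrix_Kernel"
    "Jordan_Normal_Form.Gauss_Jordan_Elimination"
begin

definition simplicial_complex :: "'v set set \<Rightarrow> bool" where
  "simplicial_complex K \<longleftrightarrow>
     finite K \<and> (\<forall>s\<in>K. finite s \<and> s \<noteq> {}) \<and> (\<forall>s\<in>K. \<forall>t. t \<subseteq> s \<and> t \<noteq> {} \<longrightarrow> t \<in> K)"

(* The order k is an integer so that the index -1 makes sense: since simplices are nonempty,
   there are no simplices of order -1, and B_0 is a matrix without rows. *)
definition simplices :: "'v set set \<Rightarrow> int \<Rightarrow> 'v set set" where
  "simplices K k = {s \<in> K. int (card s) = k + 1}"

definition num_simplices :: "'v set set \<Rightarrow> int \<Rightarrow> nat" where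
  "num_simplices K k = card (simplices K k)"

(* Meaningful only for nonempty K. *)
definition complex_dim :: "'v set set \<Rightarrow> int" where
  "complex_dim K = Max ((\<lambda>s. int (card s) - 1) ` K)"

(* sx k 0, ..., sx k (D_k - 1) lists the k-simplices; it fixes the ordered basis of C_k. *)
definition simplex_enumeration :: "'v set set \<Rightarrow> (int \<Rightarrow> nat \<Rightarrow> 'v set) \<Rightarrow> bool" where
  "simplex_enumeration K sx \<longleftrightarrow>
     (\<forall>k. bij_betw (sx k) {..<num_simplices K k} (simplices K k))"

(* An orientation is an ordering of the vertices up to even permutation; ori s is a
   representative of the class chosen for s. *)
definition orientation :: "'v set set \<Rightarrow> ('v set \<Rightarrow> 'v list) \<Rightarrow> bool" where
  "orientation K ori \<longleftrightarrow> (\<forall>s\<in>K. distinct (ori s) \<and> set (ori s) = s)"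

definition same_orientation :: "'v list \<Rightarrow> 'v list \<Rightarrow> bool" where
  "same_orientation xs ys \<longleftrightarrow>
     (\<exists>p. p permutes {..<length xs} \<and> evenperm p \<and> permute_list p xs = ys)"

(* Coefficient of the oriented simplex [xs] (xs distinct) at the basis element t, using that
   an odd reordering of the vertices changes the sign. *)
definition oriented_coeff :: "('v set \<Rightarrow> 'v list) \<Rightarrow> 'v list \<Rightarrow> 'v set \<Rightarrow> real" where
  "oriented_coeff ori xs t =
     (if set xs = t then if same_orientation (ori t) xs then 1 else - 1 else 0)"

definition delete_nth :: "nat \<Rightarrow> 'v list \<Rightarrow> 'v list" where
  "delete_nth j xs = take j xs @ drop (Suc j) xs"

(* Coefficient at t of the sum over j of (-1)^j [v_0, ..., v_k] \ [v_j],
   where [v_0, ..., v_k] is the oriented simplex s. *)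
definition incidence_number :: "('v set \<Rightarrow> 'v list) \<Rightarrow> 'v set \<Rightarrow> 'v set \<Rightarrow> real" where
  "incidence_number ori t s =
     (\<Sum>j<length (ori s). (- 1) ^ j * oriented_coeff ori (delete_nth j (ori s)) t)"

lemma set_delete_nth:
  assumes "distinct xs" and "j < length xs"
  shows "set (delete_nth j xs) = set xs - {xs ! j}"
proof -
  have eq: "xs = take j xs @ xs ! j # drop (Suc j) xs"
    using assms(2) by (rule id_take_nth_drop)
  have "distinct (take j xs @ xs ! j # drop (Suc j) xs)"
    using assms(1) eq by metis
  moreover have "set xs = set (take j xs @ xs ! j # drop (Suc j) xs)"
    using eq by metis
  ultimately show ?thesis
    unfolding delete_nth_def by auto
qed

lemma incidence_number_face:
  assumes "distinct (ori s)" and "j < length (ori s)" and "t = set (ori s) - {ori s ! j}"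
  shows "incidence_number ori t s =
    (- 1) ^ j * (if same_orientation (ori t) (delete_nth j (ori s)) then 1 else - 1)"
proof -
  have "oriented_coeff ori (delete_nth i (ori s)) t = 0" if "i < length (ori s)" "i \<noteq> j" for i
  proof -
    have "ori s ! i \<noteq> ori s ! j"
      using assms(1,2) that by (simp add: nth_eq_iff_index_eq)
    then have "set (delete_nth i (ori s)) \<noteq> t"
      using set_delete_nth[OF assms(1) that(1)] assms(3) that(1) nth_mem by fastforce
    then show ?thesis by (simp add: oriented_coeff_def)
  qed
  then have "incidence_number ori t s = (- 1) ^ j * oriented_coeff ori (delete_nth j (ori s)) t"
    unfolding incidence_number_def
    using assms(2) by (subst sum.remove[of _ j]) (auto intro!: sum.neutral)
  then show ?thesis
    using set_delete_nth[OF assms(1,2)] assms(3) by (simp add: oriented_coeff_def)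
qed

lemma incidence_number_not_face:
  assumes "distinct (ori s)" and "\<not> t \<subseteq> set (ori s)"
  shows "incidence_number ori t s = 0"
  unfolding incidence_number_def oriented_coeff_def
  using assms set_delete_nth[OF assms(1)] by (auto intro!: sum.neutral)

definition incidence_mat ::
  "'v set set \<Rightarrow> ('v set \<Rightarrow> 'v list) \<Rightarrow> (int \<Rightarrow> nat \<Rightarrow> 'v set) \<Rightarrow> int \<Rightarrow> real mat" where
  "incidence_mat K ori sx k =
     mat (num_simplices K (k - 1)) (num_simplices K k)
       (\<lambda>(i, j). incidence_number ori (sx (k - 1) i) (sx k j))"

definition weight_mat ::
  "'v set set \<Rightarrow> ('v set \<Rightarrow> real) \<Rightarrow> (int \<Rightarrow> nat \<Rightarrow> 'v set) \<Rightarrow> int \<Rightarrow> real mat" where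
  "weight_mat K w sx k = mat_diag (num_simplices K k) (\<lambda>i. w (sx k i))"

(* Unspecified for a singular matrix; weight matrices of positive weights are invertible. *)
definition mat_inv :: "real mat \<Rightarrow> real mat" where
  "mat_inv A = the (mat_inverse A)"

lemma mat_inv_weight_mat:
  assumes "simplex_enumeration K sx" and "\<And>s. s \<in> K \<Longrightarrow> w s > 0"
  shows "mat_inv (weight_mat K w sx k) = mat_diag (num_simplices K k) (\<lambda>i. 1 / w (sx k i))"
proof -
  let ?n = "num_simplices K k"
  let ?W = "weight_mat K w sx k"
  let ?V = "mat_diag ?n (\<lambda>i. 1 / w (sx k i))"
  have W: "?W \<in> carrier_mat ?n ?n" and V: "?V \<in> carrier_mat ?n ?n"
    by (simp_all add: weight_mat_def)
  have pos: "w (sx k i) > 0" if "i < ?n" for i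
    using assms that by (auto simp: simplex_enumeration_def simplices_def bij_betw_def)
  have WV: "?W * ?V = 1\<^sub>m ?n" and VW: "?V * ?W = 1\<^sub>m ?n"
    unfolding weight_mat_def mat_diag_diag
    by (rule eq_matI; use pos in \<open>force simp: mat_diag_def less_imp_neq\<close>)+
  have "?W \<in> Units (ring_mat TYPE(real) ?n ())"
    using W V WV VW by (auto simp: Units_def ring_mat_def)
  then obtain B where B: "mat_inverse ?W = Some B"
    using mat_inverse(1)[OF W] by fastforce
  have BW: "B * ?W = 1\<^sub>m ?n" and Bc: "B \<in> carrier_mat ?n ?n"
    using mat_inverse(2)[OF W B] by auto
  have "B = B * (?W * ?V)"
    using Bc WV by simp
  also have "\<dots> = ?V"
    using assoc_mult_mat[OF Bc W V] BW V by simp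
  finally show ?thesis
    by (simp add: mat_inv_def B)
qed

definition boundary_mat ::
  "'v set set \<Rightarrow> ('v set \<Rightarrow> 'v list) \<Rightarrow> ('v set \<Rightarrow> real) \<Rightarrow> (int \<Rightarrow> nat \<Rightarrow> 'v set) \<Rightarrow> int \<Rightarrow> real mat"
where
  "boundary_mat K ori w sx k =
     mat_inv (weight_mat K w sx (k - 1)) * incidence_mat K ori sx k * weight_mat K w sx k"

definition coboundary_mat ::
  "'v set set \<Rightarrow> ('v set \<Rightarrow> 'v list) \<Rightarrow> (int \<Rightarrow> nat \<Rightarrow> 'v set) \<Rightarrow> int \<Rightarrow> real mat" where
  "coboundary_mat K ori sx k = transpose_mat (incidence_mat K ori sx k)"

definition hodge_laplacian ::
  "'v set set \<Rightarrow> ('v set \<Rightarrow> 'v list) \<Rightarrow> ('v set \<Rightarrow> real) \<Rightarrow> (int \<Rightarrow> nat \<Rightarrow> 'v set) \<Rightarrow> int \<Rightarrow> real mat"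
where
  "hodge_laplacian K ori w sx k =
     transpose_mat (incidence_mat K ori sx k) * mat_inv (weight_mat K w sx (k - 1))
       * incidence_mat K ori sx k * weight_mat K w sx k
     + mat_inv (weight_mat K w sx k) * incidence_mat K ori sx (k + 1)
       * weight_mat K w sx (k + 1) * transpose_mat (incidence_mat K ori sx (k + 1))"

definition mat_image :: "real mat \<Rightarrow> real vec set" where
  "mat_image A = (\<lambda>x. A *\<^sub>v x) ` carrier_vec (dim_col A)"

abbreviation real_subspace :: "nat \<Rightarrow> real vec set \<Rightarrow> bool" where
  "real_subspace n U \<equiv> subspace class_ring U (module_vec TYPE(real) n)"

definition is_direct_sum3 :: "nat \<Rightarrow> real vec set \<Rightarrow> real vec set \<Rightarrow> real vec set \<Rightarrow> bool" where
  "is_direct_sum3 n U V W \<longleftrightarrow>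
     real_subspace n U \<and> real_subspace n V \<and> real_subspace n W \<and>
     (\<forall>x\<in>carrier_vec n. \<exists>!(u, v, y). u \<in> U \<and> v \<in> V \<and> y \<in> W \<and> x = u + v + y)"

end

theory Submission
  imports Defs
begin

text \<open>Appending \<open>c\<close> columns of ones to the 0/1 matrix that matches the vertices of a list \<open>xs\<close> with
  those of an oriented simplex turns signs into determinants: for \<open>c = 0\<close> the determinant compares
  two orientations, for \<open>c = 1\<close> Laplace expansion along the column of ones gives the incidence
  number, and for \<open>c = 2\<close> the same expansion gives the entries of \<open>B\<^sub>k B\<^sub>k\<^sub>+\<^sub>1\<close>, which vanish because two
  columns agree.

  Given \<open>B\<^sub>k B\<^sub>k\<^sub>+\<^sub>1 = 0\<close>, the three summands are orthogonal for the inner product \<open>\<langle>x, y\<rangle> = x\<^sup>T W\<^sub>k y\<close>,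
  for which \<open>L\<^sub>k\<close> is symmetric and positive semidefinite. If the columns of \<open>C\<close> span \<open>Ker L\<^sub>k\<close>, then
  \<open>L\<^sub>k + C C\<^sup>T W\<^sub>k\<close> is positive definite, hence invertible, so every vector is a sum of an element of
  \<open>Im L\<^sub>k\<close> and one of \<open>Ker L\<^sub>k\<close>; the two terms of \<open>L\<^sub>k\<close> split the former.\<close>

subsection \<open>Consecutive incidence matrices\<close>

text \<open>The columns of ones come first, so that expanding along column 0 produces exactly the
  signs of the boundary operator. The size is read off \<open>xs\<close>; the intended shape is
  \<open>length xs = c + length ys\<close>.\<close>

definition indicator_mat :: "nat \<Rightarrow> 'v list \<Rightarrow> 'v list \<Rightarrow> real mat" where
  "indicator_mat c xs ys = mat (length xs) (length xs)
     (\<lambda>(i, j). if j < c \<or> xs ! i = ys ! (j - c) then 1 else 0)"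

lemma indicator_mat_carrier [simp]: "indicator_mat c xs ys \<in> carrier_mat (length xs) (length xs)"
  by (simp add: indicator_mat_def)

lemma indicator_mat_index:
  assumes "i < length xs" "j < length xs"
  shows "indicator_mat c xs ys $$ (i, j) = (if j < c \<or> xs ! i = ys ! (j - c) then 1 else 0)"
  using assms by (simp add: indicator_mat_def)

lemma nth_delete_nth:
  assumes "j < length xs" "i < length xs - 1"
  shows "delete_nth j xs ! i = xs ! (if i < j then i else Suc i)"
  using assms by (auto simp: delete_nth_def nth_append min_def)

lemma length_delete_nth: "j < length xs \<Longrightarrow> length (delete_nth j xs) = length xs - 1"
  by (simp add: delete_nth_def)

lemma distinct_delete_nth:
  assumes "distinct xs"
  shows "distinct (delete_nth j xs)"
proof -
  have "set (take j xs) \<inter> set (drop (Suc j) xs) = {}"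
    using assms by (intro set_take_disj_set_drop_if_distinct) auto
  then show ?thesis
    using assms by (simp add: delete_nth_def)
qed

text \<open>Laplace expansion along column 0, whose entries are all 1. Deleting row \<open>j\<close>
  removes the vertex \<open>xs ! j\<close>, deleting column 0 lowers \<open>c\<close> by one, and
  the cofactor sign is \<open>(- 1) ^ j\<close>.\<close>

lemma det_indicator_mat_Suc:
  assumes "xs \<noteq> []"
  shows "det (indicator_mat (Suc c) xs ys) =
    (\<Sum>j<length xs. (- 1) ^ j * det (indicator_mat c (delete_nth j xs) ys))"
proof -
  let ?A = "indicator_mat (Suc c) xs ys"
  have "mat_delete ?A j 0 = indicator_mat c (delete_nth j xs) ys" if "j < length xs" for j
    using that by (intro eq_matI)
      (auto simp: mat_delete_def indicator_mat_def length_delete_nth nth_delete_nth)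
  moreover have "?A $$ (j, 0) = 1" if "j < length xs" for j
    using that by (subst indicator_mat_index) auto
  ultimately have "?A $$ (j, 0) * cofactor ?A j 0 =
      (- 1) ^ j * det (indicator_mat c (delete_nth j xs) ys)" if "j < length xs" for j
    using that by (simp add: cofactor_def)
  then show ?thesis
    using assms by (subst laplace_expansion_column[OF indicator_mat_carrier, of 0]) auto
qed

text \<open>Reordering \<open>xs\<close> permutes the rows; the leading columns are constant and
  hence unaffected, so the same sign appears for every \<open>c\<close>.\<close>

lemma det_indicator_mat_permute:
  assumes p: "p permutes {..<length xs}"
  shows "det (indicator_mat c (permute_list p xs) ys) = of_int (sign p) * det (indicator_mat c xs ys)"
proof -
  have "p i < length xs" if "i < length xs" for i
    using permutes_in_image[OF p] that by simp
  then have "indicator_mat c (permute_list p xs) ys =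
      mat (length xs) (length xs) (\<lambda>(i, j). indicator_mat c xs ys $$ (p i, j))"
    using p by (intro eq_matI) (auto simp: indicator_mat_def permute_list_nth atLeast0LessThan)
  then show ?thesis
    using det_permute_rows[OF indicator_mat_carrier, of p xs c ys] p by (simp add: atLeast0LessThan)
qed

lemma det_indicator_mat_2:
  assumes "2 \<le> length xs"
  shows "det (indicator_mat 2 xs ys) = 0"
proof (rule det_identical_columns[OF indicator_mat_carrier, of 0 1])
  show "col (indicator_mat 2 xs ys) 0 = col (indicator_mat 2 xs ys) 1"
  proof (rule eq_vecI)
    fix i assume "i < dim_vec (col (indicator_mat 2 xs ys) 1)"
    then have "i < length xs" by (simp add: indicator_mat_def)
    moreover from this have "indicator_mat 2 xs ys $$ (i, j) = 1" if "j < 2" for j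
      using that assms by (subst indicator_mat_index) auto
    ultimately show "col (indicator_mat 2 xs ys) 0 $ i = col (indicator_mat 2 xs ys) 1 $ i"
      using assms carrier_matD[OF indicator_mat_carrier[of 2 xs ys]]
      by (subst (1 2) index_col) auto
  qed simp
qed (use assms in auto)

lemma det_indicator_mat_same:
  assumes "distinct xs"
  shows "det (indicator_mat 0 xs xs) = 1"
proof -
  have "indicator_mat 0 xs xs = 1\<^sub>m (length xs)"
    using assms by (intro eq_matI) (auto simp: indicator_mat_def nth_eq_iff_index_eq)
  then show ?thesis by simp
qed

text \<open>Some vertex of \<open>ys\<close> is missing from \<open>xs\<close>, and its column is
  zero. Otherwise \<open>set ys\<close> would lie in \<open>set xs\<close>, and counting elements
  would force equality.\<close>

lemma det_indicator_mat_neq: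
  assumes "distinct ys" "length xs = length ys" "set xs \<noteq> set ys"
  shows "det (indicator_mat 0 xs ys) = 0"
proof -
  have "\<not> set ys \<subseteq> set xs"
  proof
    assume sub: "set ys \<subseteq> set xs"
    have "card (set xs) \<le> card (set ys)"
      using assms card_length[of xs] by (simp add: distinct_card)
    then show False
      using sub assms(3) card_seteq[of "set xs" "set ys"] by auto
  qed
  then obtain j where j: "j < length ys" "ys ! j \<notin> set xs"
    by (metis in_set_conv_nth subsetI)
  have "indicator_mat 0 xs ys $$ (i, j) = 0" if "i < length xs" for i
    using that j assms(2) by (subst indicator_mat_index) (auto simp: in_set_conv_nth)
  then show ?thesis
    using j assms(2) by (subst laplace_expansion_column[OF indicator_mat_carrier, of j]) auto
qed

section \<open>Orientations and incidence numbers as determinants\<close>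

lemma distinct_same_set_permutation:
  assumes "distinct xs" "distinct ys" "set xs = set ys"
  obtains p where "p permutes {..<length ys}" "permute_list p ys = xs"
  using assms mset_eq_permutation[of xs ys] set_eq_iff_mset_eq_distinct by blast

text \<open>\<open>same_orientation\<close> asks for some even permutation. Since the entries are
  distinct, only one permutation carries \<open>xs\<close> to a given reordering, so its parity
  decides.\<close>

lemma same_orientation_permute_list:
  assumes "distinct xs" and p: "p permutes {..<length xs}"
  shows "same_orientation xs (permute_list p xs) \<longleftrightarrow> evenperm p"
proof
  assume "same_orientation xs (permute_list p xs)"
  then obtain q where q: "q permutes {..<length xs}" "evenperm q"
    and eq: "permute_list q xs = permute_list p xs"
    by (auto simp: same_orientation_def)
  have "q i = p i" for i
  proof (cases "i < length xs")
    case True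
    then have "xs ! q i = xs ! p i"
      using eq q(1) p by (metis permute_list_nth)
    moreover have "q i < length xs" "p i < length xs"
      using True q(1) p permutes_in_image by fastforce+
    ultimately show ?thesis
      using assms(1) nth_eq_iff_index_eq by blast
  next
    case False
    then show ?thesis
      using p q(1) by (simp add: permutes_def)
  qed
  then have "q = p" by auto
  then show "evenperm p" using q(2) by simp
qed (use p in \<open>auto simp: same_orientation_def\<close>)

text \<open>If the vertex sets agree, the matrix is a row permutation of the identity and its
  determinant is the sign of the reordering; if they differ, it has a zero column.\<close>

lemma oriented_coeff_eq_det:
  assumes "distinct xs" "distinct (ori t)" "set (ori t) = t" "length xs = length (ori t)"
  shows "oriented_coeff ori xs t = det (indicator_mat 0 xs (ori t))"
proof (cases "set xs = t")
  case True
  then obtain p where p: "p permutes {..<length (ori t)}" "permute_list p (ori t) = xs"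
    using distinct_same_set_permutation assms by metis
  have "same_orientation (ori t) xs \<longleftrightarrow> evenperm p"
    using same_orientation_permute_list[OF assms(2) p(1)] p(2) by simp
  then show ?thesis
    using det_indicator_mat_permute[OF p(1), of 0 "ori t"] det_indicator_mat_same[OF assms(2)] True
    by (simp add: oriented_coeff_def p(2) sign_def)
next
  case False
  then show ?thesis
    using assms det_indicator_mat_neq[of "ori t" xs] by (simp add: oriented_coeff_def)
qed

text \<open>The alternating sum defining the incidence number is the expansion of the
  \<open>c = 1\<close> determinant along its column of ones.\<close>

lemma incidence_number_eq_det:
  assumes "distinct (ori s)" "distinct (ori t)" "set (ori t) = t" "length (ori s) = Suc (length (ori t))"
  shows "incidence_number ori t s = det (indicator_mat 1 (ori s) (ori t))"
proof -
  have "oriented_coeff ori (delete_nth j (ori s)) t = det (indicator_mat 0 (delete_nth j (ori s)) (ori t))"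
    if "j < length (ori s)" for j
    using that assms by (intro oriented_coeff_eq_det) (auto simp: distinct_delete_nth length_delete_nth)
  then have "incidence_number ori t s =
      (\<Sum>j<length (ori s). (- 1) ^ j * det (indicator_mat 0 (delete_nth j (ori s)) (ori t)))"
    unfolding incidence_number_def by simp
  also have "\<dots> = det (indicator_mat (Suc 0) (ori s) (ori t))"
    using assms(4) by (subst det_indicator_mat_Suc) auto
  finally show ?thesis by simp
qed

text \<open>Replacing \<open>xs\<close> by the chosen representative of its simplex changes both factors
  by the same sign.\<close>
lemma oriented_coeff_times_incidence_number:
  assumes "distinct xs" "distinct (ori (set xs))" "set (ori (set xs)) = set xs"
    and "distinct (ori r)" "set (ori r) = r" "length xs = Suc (length (ori r))"
  shows "oriented_coeff ori xs (set xs) * incidence_number ori r (set xs) =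
    det (indicator_mat 1 xs (ori r))"
proof -
  let ?ys = "ori (set xs)"
  obtain p where p: "p permutes {..<length ?ys}" "permute_list p ?ys = xs"
    using distinct_same_set_permutation assms(1-3) by metis
  have len: "length ?ys = length xs"
    using p(2) length_permute_list by metis
  have "oriented_coeff ori xs (set xs) = of_int (sign p)"
    using oriented_coeff_eq_det[of xs ori "set xs"] assms len det_indicator_mat_permute[OF p(1), of 0 ?ys]
      det_indicator_mat_same[OF assms(2)] by (simp add: p(2))
  moreover have "incidence_number ori r (set xs) = det (indicator_mat 1 ?ys (ori r))"
    using assms len by (intro incidence_number_eq_det) auto
  ultimately show ?thesis
    using det_indicator_mat_permute[OF p(1), of 1 "ori r"] by (simp add: p(2))
qed

section \<open>The product of consecutive incidence matrices\<close>

lemma length_orientation: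
  assumes "orientation K ori" "s \<in> simplices K k"
  shows "int (length (ori s)) = k + 1"
  using assms distinct_card[of "ori s"] by (auto simp: orientation_def simplices_def)

text \<open>This is one entry of the product of two consecutive incidence matrices. Expanding the
  second factor over the vertices deleted from \<open>s\<close> leaves, for each of them, a
  \<open>c = 1\<close> determinant; their alternating sum is a \<open>c = 2\<close>
  determinant.\<close>

lemma sum_incidence_numbers:
  assumes K: "simplicial_complex K" and ori: "orientation K ori"
    and r: "r \<in> simplices K (k - 1)" and s: "s \<in> simplices K (k + 1)"
  shows "(\<Sum>t\<in>simplices K k. incidence_number ori r t * incidence_number ori t s) = 0"
proof -
  let ?xs = "ori s"
  let ?d = "\<lambda>j. delete_nth j ?xs"
  have ori_simplex: "distinct (ori u)" "set (ori u) = u" if "u \<in> K" for u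
    using ori that by (auto simp: orientation_def)
  have rK: "r \<in> K" and sK: "s \<in> K"
    using r s by (auto simp: simplices_def)
  have len: "length ?xs = Suc (Suc (length (ori r)))"
    using length_orientation[OF ori r] length_orientation[OF ori s] by linarith
  have fin: "finite (simplices K k)"
    using K by (auto simp: simplicial_complex_def simplices_def)
  \<comment> \<open>One vertex more than \<open>r\<close> remains, so the face is nonempty, as
    closure of \<open>K\<close> under subsets requires.\<close>
  have face: "set (?d j) \<in> simplices K k" if j: "j < length ?xs" for j
  proof -
    have card: "card (set (?d j)) = Suc (length (ori r))"
      using distinct_card[OF distinct_delete_nth[OF ori_simplex(1)[OF sK]], of j]
      by (simp add: length_delete_nth[OF j] len)
    then have "set (?d j) \<noteq> {}"
      by (metis card.empty nat.distinct(1))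
    moreover have "set (?d j) \<subseteq> s"
      using set_delete_nth[OF ori_simplex(1)[OF sK] j] ori_simplex(2)[OF sK] by auto
    ultimately have "set (?d j) \<in> K"
      using K sK unfolding simplicial_complex_def by blast
    then show ?thesis
      using card length_orientation[OF ori r] by (simp add: simplices_def)
  qed
  have inner: "(\<Sum>t\<in>simplices K k. oriented_coeff ori (?d j) t * incidence_number ori r t) =
      det (indicator_mat 1 (?d j) (ori r))" if j: "j < length ?xs" for j
  proof -
    \<comment> \<open>\<open>oriented_coeff\<close> vanishes unless \<open>t\<close> is the vertex
      set of the list, so a single term survives.\<close>
    have "(\<Sum>t\<in>simplices K k. oriented_coeff ori (?d j) t * incidence_number ori r t) =
        (\<Sum>t\<in>{set (?d j)}. oriented_coeff ori (?d j) t * incidence_number ori r t)"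
      using fin face[OF j] by (intro sum.mono_neutral_right) (simp_all add: oriented_coeff_def)
    also have "\<dots> = det (indicator_mat 1 (?d j) (ori r))"
    proof -
      have "set (?d j) \<in> K"
        using face[OF j] by (simp add: simplices_def)
      moreover have "distinct (?d j)"
        using ori_simplex(1)[OF sK] by (rule distinct_delete_nth)
      moreover have "length (?d j) = Suc (length (ori r))"
        using len by (simp add: length_delete_nth[OF j])
      ultimately have "oriented_coeff ori (?d j) (set (?d j)) * incidence_number ori r (set (?d j)) =
          det (indicator_mat 1 (?d j) (ori r))"
        using ori_simplex rK by (intro oriented_coeff_times_incidence_number)
      then show ?thesis by simp
    qed
    finally show ?thesis .
  qed
  have "(\<Sum>t\<in>simplices K k. incidence_number ori r t * incidence_number ori t s) =
      (\<Sum>j<length ?xs. (- 1) ^ j *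
        (\<Sum>t\<in>simplices K k. oriented_coeff ori (?d j) t * incidence_number ori r t))"
    unfolding incidence_number_def[of ori _ s] sum_distrib_left
    by (subst sum.swap) (simp add: mult_ac)
  also have "\<dots> = (\<Sum>j<length ?xs. (- 1) ^ j * det (indicator_mat 1 (?d j) (ori r)))"
    by (rule sum.cong) (simp_all add: inner)
  also have "\<dots> = det (indicator_mat (Suc 1) ?xs (ori r))"
    using len by (subst det_indicator_mat_Suc) auto
  also have "\<dots> = 0"
    using det_indicator_mat_2[of ?xs "ori r"] len by (simp add: numeral_2_eq_2)
  finally show ?thesis .
qed

lemma incidence_mat_mult_zero:
  assumes K: "simplicial_complex K" and ori: "orientation K ori" and sx: "simplex_enumeration K sx"
  shows "incidence_mat K ori sx k * incidence_mat K ori sx (k + 1) =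
    0\<^sub>m (num_simplices K (k - 1)) (num_simplices K (k + 1))"
proof (rule eq_matI)
  fix i j
  assume "i < dim_row (0\<^sub>m (num_simplices K (k - 1)) (num_simplices K (k + 1)) :: real mat)"
    and "j < dim_col (0\<^sub>m (num_simplices K (k - 1)) (num_simplices K (k + 1)) :: real mat)"
  then have i: "i < num_simplices K (k - 1)" and j: "j < num_simplices K (k + 1)"
    by auto
  have bij: "bij_betw (sx l) {..<num_simplices K l} (simplices K l)" for l
    using sx by (simp add: simplex_enumeration_def)
  let ?r = "sx (k - 1) i" and ?s = "sx (k + 1) j"
  have r: "?r \<in> simplices K (k - 1)" and s: "?s \<in> simplices K (k + 1)"
    using bij_betwE[OF bij[of "k - 1"]] bij_betwE[OF bij[of "k + 1"]] i j by auto
  have "(incidence_mat K ori sx k * incidence_mat K ori sx (k + 1)) $$ (i, j) =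
      (\<Sum>l<num_simplices K k. incidence_number ori ?r (sx k l) * incidence_number ori (sx k l) ?s)"
    using i j by (simp add: incidence_mat_def scalar_prod_def atLeast0LessThan)
  also have "\<dots> = (\<Sum>t\<in>simplices K k. incidence_number ori ?r t * incidence_number ori t ?s)"
    \<comment> \<open>The enumeration \<open>sx k\<close> turns the sum over matrix indices into a
      sum over simplices.\<close>
    by (rule sum.reindex_bij_betw[OF bij])
  also have "\<dots> = 0"
    by (rule sum_incidence_numbers[OF K ori r s])
  finally show "(incidence_mat K ori sx k * incidence_mat K ori sx (k + 1)) $$ (i, j) =
      0\<^sub>m (num_simplices K (k - 1)) (num_simplices K (k + 1)) $$ (i, j)"
    using i j by (simp only: index_zero_mat(1))
qed (simp_all add: incidence_mat_def)

subsection \<open>Weighted Hodge decomposition\<close>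

text \<open>The columns of \<open>C\<close> list a finite basis of the kernel. Writing the kernel as
  an image allows \<open>C\<close> and its transpose to be used as matrices in
  \<open>image_plus_kernel\<close>.\<close>

lemma mat_kernel_eq_mat_image:
  assumes A: "(A :: real mat) \<in> carrier_mat m n"
  obtains C r where "C \<in> carrier_mat n r" "mat_kernel A = mat_image C"
proof -
  interpret kernel m n A by (unfold_locales) (rule A)
  obtain B where B: "finite B" "basis B"
    using kernel_basis_exists[OF A] by blast
  then have sub: "B \<subseteq> mat_kernel A" and span: "span B = mat_kernel A"
    by (auto simp: Ker.basis_def)
  obtain bs where bs: "set bs = B"
    using finite_list[OF B(1)] by blast
  have car: "set bs \<subseteq> carrier_vec n"
    using sub bs mat_kernel_carrier[OF A] by auto
  \<comment> \<open>The basis spans inside the kernel viewed as a space of its own;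
    \<open>span_same\<close> identifies this with the span in the ambient space.\<close>
  have "mat_kernel A = NC.span (set bs)"
    using span span_same[OF sub] bs by simp
  also have "\<dots> = NC.span_list bs"
    using NC.span_list_as_span[OF car] by simp
  also have "\<dots> = mat_image (mat_of_cols n bs)"
  proof -
    have *: "\<forall>v\<in>set bs. dim_vec v = n" using car by auto
    \<comment> \<open>\<open>span_list\<close> ranges over coefficient functions on all naturals,
      \<open>mat_image\<close> over coefficient vectors; only the first \<open>length bs\<close>
      values matter.\<close>
    have "NC.span_list bs = (\<lambda>c. mat_of_cols n bs *\<^sub>v vec (length bs) c) ` UNIV"
      unfolding NC.span_list_def by (auto simp: NC.lincomb_list_as_mat_mult[OF *])
    also have "\<dots> = mat_image (mat_of_cols n bs)"
      unfolding mat_image_def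
    proof (intro equalityI subsetI)
      fix y assume "y \<in> (*\<^sub>v) (mat_of_cols n bs) ` carrier_vec (dim_col (mat_of_cols n bs))"
      then obtain x where x: "x \<in> carrier_vec (length bs)" "y = mat_of_cols n bs *\<^sub>v x" by auto
      have "vec (length bs) (\<lambda>i. x $ i) = x" using x(1) by auto
      then have "y = mat_of_cols n bs *\<^sub>v vec (length bs) (\<lambda>i. x $ i)" using x(2) by simp
      then show "y \<in> range (\<lambda>c. mat_of_cols n bs *\<^sub>v vec (length bs) c)" by blast
    qed auto
    finally show ?thesis .
  qed
  finally show ?thesis
    by (rule that[rotated]) (rule mat_of_cols_carrier(1))
qed

lemma mat_image_subspace:
  assumes A: "A \<in> carrier_mat n m"
  shows "real_subspace n (mat_image A)"
proof -
  interpret vec_space "TYPE(real)" n .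
  have "submodule class_ring (mat_image A) (module_vec TYPE(real) n)"
  proof (rule submodule.intro)
    fix v w assume "v \<in> mat_image A" "w \<in> mat_image A"
    then obtain x y where "x \<in> carrier_vec m" "y \<in> carrier_vec m" "v = A *\<^sub>v x" "w = A *\<^sub>v y"
      using A by (auto simp: mat_image_def)
    then have "v + w = A *\<^sub>v (x + y)" "x + y \<in> carrier_vec m"
      using A by (auto simp: mult_add_distrib_mat_vec)
    then show "v \<oplus>\<^bsub>module_vec TYPE(real) n\<^esub> w \<in> mat_image A"
      using A by (auto simp: mat_image_def module_vec_def)
  next
    have "0\<^sub>v n = A *\<^sub>v 0\<^sub>v m"
      using A by auto
    then show "\<zero>\<^bsub>module_vec TYPE(real) n\<^esub> \<in> mat_image A"
      using A by (auto simp: mat_image_def module_vec_def)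
  next
    fix c :: real and v assume "v \<in> mat_image A"
    then obtain x where "x \<in> carrier_vec m" "v = A *\<^sub>v x"
      using A by (auto simp: mat_image_def)
    then have "c \<cdot>\<^sub>v v = A *\<^sub>v (c \<cdot>\<^sub>v x)" "c \<cdot>\<^sub>v x \<in> carrier_vec m"
      using A by (auto simp: mult_mat_vec)
    then show "c \<odot>\<^bsub>module_vec TYPE(real) n\<^esub> v \<in> mat_image A"
      using A by (auto simp: mat_image_def module_vec_def)
  qed (use A vec_module in \<open>auto simp: mat_image_def module_vec_def\<close>)
  then show ?thesis
    by (simp add: subspace_def vec_vs)
qed

lemma mat_kernel_subspace:
  assumes A: "A \<in> carrier_mat m n"
  shows "real_subspace n (mat_kernel A)"
proof -
  obtain C r where "C \<in> carrier_mat n r" "mat_kernel A = mat_image C"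
    using mat_kernel_eq_mat_image[OF A] .
  then show ?thesis using mat_image_subspace by simp
qed

lemma mat_mult_zero_vec:
  "(A :: 'a :: comm_semiring_1 mat) \<in> carrier_mat m n \<Longrightarrow> A *\<^sub>v 0\<^sub>v n = 0\<^sub>v m"
  by auto

lemma zero_mat_mult_vec:
  "(x :: 'a :: comm_semiring_1 vec) \<in> carrier_vec n \<Longrightarrow> 0\<^sub>m m n *\<^sub>v x = 0\<^sub>v m"
  by auto

section \<open>Inner products with diagonal weights\<close>

lemma scalar_prod_mat_diag:
  fixes d :: "nat \<Rightarrow> real"
  assumes "x \<in> carrier_vec n" "y \<in> carrier_vec n"
  shows "x \<bullet> (mat_diag n d *\<^sub>v y) = (\<Sum>i<n. d i * x $ i * y $ i)"
proof -
  have "(mat_diag n d *\<^sub>v y) $ i = d i * y $ i" if "i < n" for i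
    using that assms(2) by (auto simp: mat_diag_def scalar_prod_def if_distrib[of "\<lambda>a. a * _"] cong: if_cong)
  moreover have "dim_vec (mat_diag n d *\<^sub>v y) = n" by (simp add: mat_diag_def)
  ultimately show ?thesis
    by (auto simp: scalar_prod_def[of x] atLeast0LessThan mult_ac intro!: sum.cong)
qed

lemma scalar_prod_mat_diag_nonneg:
  fixes d :: "nat \<Rightarrow> real"
  assumes "x \<in> carrier_vec n" "\<And>i. i < n \<Longrightarrow> d i > 0"
  shows "0 \<le> x \<bullet> (mat_diag n d *\<^sub>v x)"
  unfolding scalar_prod_mat_diag[OF assms(1,1)]
  using assms(2) by (auto intro!: sum_nonneg simp: mult.assoc less_imp_le)

lemma scalar_prod_mat_diag_eq_0:
  fixes d :: "nat \<Rightarrow> real"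
  assumes x: "x \<in> carrier_vec n" and d: "\<And>i. i < n \<Longrightarrow> d i > 0"
    and "x \<bullet> (mat_diag n d *\<^sub>v x) = 0"
  shows "x = 0\<^sub>v n"
proof -
  have "(\<Sum>i<n. d i * x $ i * x $ i) = 0"
    using assms(3) scalar_prod_mat_diag[OF x x, of d] by simp
  then have "\<forall>i\<in>{..<n}. d i * x $ i * x $ i = 0"
    using d by (subst (asm) sum_nonneg_eq_0_iff) (auto simp: mult.assoc less_imp_le)
  then show ?thesis
    using x d by (intro eq_vecI) force+
qed

section \<open>Decomposition for two matrices with product zero\<close>

text \<open>\<open>B1\<close> and \<open>B2\<close> stand for \<open>B\<^sub>k\<close> and
  \<open>B\<^sub>k\<^sub>+\<^sub>1\<close>, \<open>d\<close> and \<open>f\<close> for the weights of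
  the simplices of orders \<open>k\<close> and \<open>k + 1\<close>, and \<open>e\<close> for the
  reciprocal weights in order \<open>k - 1\<close>. Of the complex, only \<open>B1_B2\<close> and
  positivity are retained.\<close>

locale weighted_pair =
  fixes n m q :: nat and B1 B2 :: "real mat" and d e f :: "nat \<Rightarrow> real"
  assumes B1: "B1 \<in> carrier_mat m n" and B2: "B2 \<in> carrier_mat n q"
    and B1_B2: "B1 * B2 = 0\<^sub>m m q"
    and d_pos: "\<And>i. i < n \<Longrightarrow> d i > 0"
    and e_pos: "\<And>i. i < m \<Longrightarrow> e i > 0"
    and f_pos: "\<And>i. i < q \<Longrightarrow> f i > 0"
begin

abbreviation "D \<equiv> mat_diag n d"
abbreviation "D' \<equiv> mat_diag n (\<lambda>i. 1 / d i)"
abbreviation "E \<equiv> mat_diag m e"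
abbreviation "F \<equiv> mat_diag q f"

definition L :: "real mat" where
  "L = B1\<^sup>T * E * B1 * D + D' * B2 * F * B2\<^sup>T"

lemma B1T: "B1\<^sup>T \<in> carrier_mat n m" and B2T: "B2\<^sup>T \<in> carrier_mat q n"
  using B1 B2 by auto

lemma L_carrier [simp]: "L \<in> carrier_mat n n"
  using B2 B2T unfolding L_def by (metis add_carrier_mat mat_diag_dim mult_carrier_mat)

lemma vec_carrier [simp]:
  "x \<in> carrier_vec n \<Longrightarrow> D *\<^sub>v x \<in> carrier_vec n"
  "x \<in> carrier_vec n \<Longrightarrow> D' *\<^sub>v x \<in> carrier_vec n"
  "y \<in> carrier_vec m \<Longrightarrow> E *\<^sub>v y \<in> carrier_vec m"
  "z \<in> carrier_vec q \<Longrightarrow> F *\<^sub>v z \<in> carrier_vec q"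
  "x \<in> carrier_vec n \<Longrightarrow> B1 *\<^sub>v x \<in> carrier_vec m"
  "y \<in> carrier_vec m \<Longrightarrow> B1\<^sup>T *\<^sub>v y \<in> carrier_vec n"
  "z \<in> carrier_vec q \<Longrightarrow> B2 *\<^sub>v z \<in> carrier_vec n"
  "x \<in> carrier_vec n \<Longrightarrow> B2\<^sup>T *\<^sub>v x \<in> carrier_vec q"
  using B1 B2 B1T B2T mult_mat_vec_carrier mat_diag_dim by blast+

lemma D_D': "x \<in> carrier_vec n \<Longrightarrow> D *\<^sub>v (D' *\<^sub>v x) = x"
proof -
  assume x: "x \<in> carrier_vec n"
  have "D * D' = 1\<^sub>m n"
    unfolding mat_diag_diag using d_pos by (intro eq_matI) (force simp: mat_diag_def)+
  then show ?thesis
    using x assoc_mult_mat_vec[of D n n D' n x] by simp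
qed

lemma D_sym:
  "x \<in> carrier_vec n \<Longrightarrow> y \<in> carrier_vec n \<Longrightarrow> x \<bullet> (D *\<^sub>v y) = y \<bullet> (D *\<^sub>v x)"
  by (simp add: scalar_prod_mat_diag mult_ac)

lemma L_mult_vec:
  assumes x: "x \<in> carrier_vec n"
  shows "L *\<^sub>v x = B1\<^sup>T *\<^sub>v (E *\<^sub>v (B1 *\<^sub>v (D *\<^sub>v x))) + D' *\<^sub>v (B2 *\<^sub>v (F *\<^sub>v (B2\<^sup>T *\<^sub>v x)))"
proof -
  have c: "B1\<^sup>T * E \<in> carrier_mat n m" "B1\<^sup>T * E * B1 \<in> carrier_mat n n"
    "B1\<^sup>T * E * B1 * D \<in> carrier_mat n n" "D' * B2 \<in> carrier_mat n q" "D' * B2 * F \<in> carrier_mat n q"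
    "D' * B2 * F * B2\<^sup>T \<in> carrier_mat n n"
    using B1 B2 B1T B2T mult_carrier_mat mat_diag_dim by metis+
  have "L *\<^sub>v x = (B1\<^sup>T * E * B1 * D) *\<^sub>v x + (D' * B2 * F * B2\<^sup>T) *\<^sub>v x"
    unfolding L_def using add_mult_distrib_mat_vec[OF c(3) c(6) x] .
  also have "(B1\<^sup>T * E * B1 * D) *\<^sub>v x = B1\<^sup>T *\<^sub>v (E *\<^sub>v (B1 *\<^sub>v (D *\<^sub>v x)))"
    using x by (simp add: assoc_mult_mat_vec[OF c(2) mat_diag_dim] assoc_mult_mat_vec[OF c(1) B1]
        assoc_mult_mat_vec[OF B1T mat_diag_dim])
  also have "(D' * B2 * F * B2\<^sup>T) *\<^sub>v x = D' *\<^sub>v (B2 *\<^sub>v (F *\<^sub>v (B2\<^sup>T *\<^sub>v x)))"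
    using x by (simp add: assoc_mult_mat_vec[OF c(5) B2T] assoc_mult_mat_vec[OF c(4) mat_diag_dim]
        assoc_mult_mat_vec[OF mat_diag_dim B2])
  finally show ?thesis .
qed

text \<open>Adjointness: symmetry of \<open>D\<close> and transposition move
  \<open>B1\<^sup>T\<close> to the other side of the weighted inner product.\<close>

lemma inner_coboundary:
  assumes "y \<in> carrier_vec m" "x \<in> carrier_vec n"
  shows "x \<bullet> (D *\<^sub>v (B1\<^sup>T *\<^sub>v y)) = y \<bullet> (B1 *\<^sub>v (D *\<^sub>v x))"
  using assms D_sym[of x "B1\<^sup>T *\<^sub>v y"] transpose_vec_mult_scalar[OF B1, of "D *\<^sub>v x" y] by simp

text \<open>\<open>D\<close> cancels \<open>D'\<close>, which leaves plain transposition of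
  \<open>B2\<close>.\<close>

lemma inner_boundary:
  assumes "z \<in> carrier_vec q" "x \<in> carrier_vec n"
  shows "x \<bullet> (D *\<^sub>v (D' *\<^sub>v (B2 *\<^sub>v z))) = (B2\<^sup>T *\<^sub>v x) \<bullet> z"
  using assms transpose_vec_mult_scalar[OF B2, of z x] by (simp add: D_D')

text \<open>The two adjointness rules turn the quadratic form of \<open>L\<close> into a sum of two
  weighted squared norms, which gives positive semidefiniteness.\<close>

lemma inner_L:
  assumes x: "x \<in> carrier_vec n"
  shows "x \<bullet> (D *\<^sub>v (L *\<^sub>v x)) = (B1 *\<^sub>v (D *\<^sub>v x)) \<bullet> (E *\<^sub>v (B1 *\<^sub>v (D *\<^sub>v x)))
    + (B2\<^sup>T *\<^sub>v x) \<bullet> (F *\<^sub>v (B2\<^sup>T *\<^sub>v x))"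
proof -
  let ?a = "B1 *\<^sub>v (D *\<^sub>v x)" and ?b = "B2\<^sup>T *\<^sub>v x"
  have "x \<bullet> (D *\<^sub>v (L *\<^sub>v x)) = x \<bullet> (D *\<^sub>v (B1\<^sup>T *\<^sub>v (E *\<^sub>v ?a)))
      + x \<bullet> (D *\<^sub>v (D' *\<^sub>v (B2 *\<^sub>v (F *\<^sub>v ?b))))"
    using x by (simp add: L_mult_vec mult_add_distrib_mat_vec[of D n n] scalar_prod_add_distrib[of _ n])
  also have "\<dots> = (E *\<^sub>v ?a) \<bullet> ?a + ?b \<bullet> (F *\<^sub>v ?b)"
    using x inner_coboundary[of "E *\<^sub>v ?a" x] inner_boundary[of "F *\<^sub>v ?b" x] by simp
  also have "(E *\<^sub>v ?a) \<bullet> ?a = ?a \<bullet> (E *\<^sub>v ?a)"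
    using x by (intro comm_scalar_prod[of _ m]) auto
  finally show ?thesis .
qed

lemma inner_L_nonneg: "x \<in> carrier_vec n \<Longrightarrow> 0 \<le> x \<bullet> (D *\<^sub>v (L *\<^sub>v x))"
  using scalar_prod_mat_diag_nonneg e_pos f_pos by (simp add: inner_L)

text \<open>Two nonnegative terms with sum zero both vanish, and each is definite. The hypothesis
  concerns the quadratic form rather than \<open>L *\<^sub>v x\<close>, because in
  \<open>image_plus_kernel\<close> only the form is known to vanish at first.\<close>

lemma harmonic:
  assumes x: "x \<in> carrier_vec n" and "x \<bullet> (D *\<^sub>v (L *\<^sub>v x)) = 0"
  shows "B1 *\<^sub>v (D *\<^sub>v x) = 0\<^sub>v m" "B2\<^sup>T *\<^sub>v x = 0\<^sub>v q"
proof -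
  let ?a = "B1 *\<^sub>v (D *\<^sub>v x)" and ?b = "B2\<^sup>T *\<^sub>v x"
  have "0 \<le> ?a \<bullet> (E *\<^sub>v ?a)" "0 \<le> ?b \<bullet> (F *\<^sub>v ?b)"
    using x scalar_prod_mat_diag_nonneg e_pos f_pos by simp_all
  then have "?a \<bullet> (E *\<^sub>v ?a) = 0" "?b \<bullet> (F *\<^sub>v ?b) = 0"
    using assms inner_L by auto
  then show "?a = 0\<^sub>v m" "?b = 0\<^sub>v q"
    using x scalar_prod_mat_diag_eq_0[of ?a m e] scalar_prod_mat_diag_eq_0[of ?b q f] e_pos f_pos by auto
qed

lemma image_plus_kernel:
  assumes x: "x \<in> carrier_vec n"
  obtains y h where "y \<in> carrier_vec n" "h \<in> mat_kernel L" "x = L *\<^sub>v y + h"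
proof -
  obtain C r where C: "C \<in> carrier_mat n r" and ker: "mat_kernel L = mat_image C"
    using mat_kernel_eq_mat_image[OF L_carrier] .
  have CT: "C\<^sup>T \<in> carrier_mat r n" using C by simp
  define P where "P = C * (C\<^sup>T * D)"
  have P: "P \<in> carrier_mat n n" and CTD: "C\<^sup>T * D \<in> carrier_mat r n"
    unfolding P_def using C CT mult_carrier_mat mat_diag_dim by metis+
  have P_vec: "P *\<^sub>v z = C *\<^sub>v (C\<^sup>T *\<^sub>v (D *\<^sub>v z))" and CTDz: "C\<^sup>T *\<^sub>v (D *\<^sub>v z) \<in> carrier_vec r"
    if "z \<in> carrier_vec n" for z
    unfolding P_def using that C CT assoc_mult_mat_vec[OF C CTD] assoc_mult_mat_vec[OF CT mat_diag_dim]
    by (auto intro: mult_mat_vec_carrier[OF CT])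
  have M_vec: "(L + P) *\<^sub>v z = L *\<^sub>v z + P *\<^sub>v z" if "z \<in> carrier_vec n" for z
    using add_mult_distrib_mat_vec[OF L_carrier P that] .
  have Lz: "L *\<^sub>v z \<in> carrier_vec n" and Pz: "P *\<^sub>v z \<in> carrier_vec n" if "z \<in> carrier_vec n" for z
    using mult_mat_vec_carrier[OF L_carrier that] mult_mat_vec_carrier[OF P that] .
  have "z = 0\<^sub>v n" if z: "z \<in> carrier_vec n" and 0: "(L + P) *\<^sub>v z = 0\<^sub>v n" for z
  proof -
    let ?c = "C\<^sup>T *\<^sub>v (D *\<^sub>v z)"
    \<comment> \<open>The form of \<open>P\<close> is the squared length of the vector of weighted
      inner products of \<open>z\<close> with the columns of \<open>C\<close>.\<close>
    have "z \<bullet> (D *\<^sub>v (P *\<^sub>v z)) = ?c \<bullet> ?c"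
      using z D_sym[OF z Pz[OF z]] CTDz[OF z] P_vec[OF z] transpose_vec_mult_scalar[OF C, of ?c "D *\<^sub>v z"]
        comm_scalar_prod[of "D *\<^sub>v z" n "C *\<^sub>v ?c"] mult_mat_vec_carrier[OF C, of ?c]
      by simp
    moreover have "z \<bullet> (D *\<^sub>v (L *\<^sub>v z)) + z \<bullet> (D *\<^sub>v (P *\<^sub>v z)) = z \<bullet> (D *\<^sub>v ((L + P) *\<^sub>v z))"
      using z Lz Pz by (simp add: M_vec mult_add_distrib_mat_vec[of D n n] scalar_prod_add_distrib[of _ n])
    moreover have "\<dots> = 0"
      using z scalar_prod_mat_diag[of z n "0\<^sub>v n" d] by (simp add: 0)
    moreover have "0 \<le> ?c \<bullet> ?c"
      by (simp add: scalar_prod_def sum_nonneg)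
    ultimately have zL: "z \<bullet> (D *\<^sub>v (L *\<^sub>v z)) = 0" and cc: "?c \<bullet> ?c = 0"
      using inner_L_nonneg[OF z] by linarith+
    \<comment> \<open>Vanishing of the form puts \<open>z\<close> into the kernel, so
      \<open>z\<close> is a combination of the columns of \<open>C\<close>.\<close>
    have "L *\<^sub>v z = 0\<^sub>v n"
      using harmonic[OF z zL] L_mult_vec[OF z] mat_mult_zero_vec[OF B1T] mat_mult_zero_vec[OF B2]
      by (simp add: mat_mult_zero_vec[OF mat_diag_dim])
    then have "z \<in> mat_kernel L"
      using z by (intro mat_kernelI[OF L_carrier]) auto
    then obtain u where u: "u \<in> carrier_vec r" "z = C *\<^sub>v u"
      using ker C by (auto simp: mat_image_def)
    have "?c = 0\<^sub>v r"
      using cc CTDz[OF z] scalar_prod_mat_diag_eq_0[of ?c r "\<lambda>_. 1"] by simp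
    \<comment> \<open>\<open>z\<close> is both a combination of the columns of \<open>C\<close> and
      orthogonal to all of them, hence orthogonal to itself.\<close>
    then have "z \<bullet> (D *\<^sub>v z) = 0"
      using z u transpose_vec_mult_scalar[OF C u(1), of "D *\<^sub>v z"]
        comm_scalar_prod[of "D *\<^sub>v z" n z] by simp
    then show ?thesis
      using scalar_prod_mat_diag_eq_0[OF z] d_pos by blast
  qed
  then have "det (L + P) \<noteq> 0"
    using det_0_iff_vec_prod_zero[of "L + P" n] P by auto
  then obtain N where N: "N \<in> carrier_mat n n" "(L + P) * N = 1\<^sub>m n"
    using det_non_zero_imp_unit[of "L + P" n "()"] P by (auto simp: Units_def ring_mat_def)
  define y where "y = N *\<^sub>v x"
  have y: "y \<in> carrier_vec n" unfolding y_def using N x by auto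
  have "x = (L + P) *\<^sub>v y"
    unfolding y_def using N x P assoc_mult_mat_vec[of "L + P" n n N n x] by simp
  then have "x = L *\<^sub>v y + P *\<^sub>v y"
    using M_vec[OF y] by simp
  moreover have "P *\<^sub>v y \<in> mat_kernel L"
    unfolding ker mat_image_def using P_vec[OF y] CTDz[OF y] C by auto
  ultimately show ?thesis using that y by blast
qed

lemma boundary_mult_vec:
  assumes "z \<in> carrier_vec q"
  shows "(D' * B2 * F) *\<^sub>v z = D' *\<^sub>v (B2 *\<^sub>v (F *\<^sub>v z))"
proof -
  have c: "D' * B2 \<in> carrier_mat n q"
    using B2 mult_carrier_mat mat_diag_dim by metis
  show ?thesis
    using assms by (simp add: assoc_mult_mat_vec[OF c mat_diag_dim] assoc_mult_mat_vec[OF mat_diag_dim B2])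
qed

lemma decomposition_exists:
  assumes x: "x \<in> carrier_vec n"
  obtains y h z where "y \<in> carrier_vec m" "h \<in> mat_kernel L" "z \<in> carrier_vec q"
    "x = B1\<^sup>T *\<^sub>v y + h + (D' * B2 * F) *\<^sub>v z"
proof -
  obtain v h where v: "v \<in> carrier_vec n" and h: "h \<in> mat_kernel L" and eq: "x = L *\<^sub>v v + h"
    using image_plus_kernel[OF x] .
  have hc: "h \<in> carrier_vec n" using mat_kernelD(1)[OF L_carrier h] .
  \<comment> \<open>The witnesses are read off the two summands of \<open>L *\<^sub>v v\<close> in
    \<open>L_mult_vec\<close>.\<close>
  let ?y = "E *\<^sub>v (B1 *\<^sub>v (D *\<^sub>v v))" and ?z = "B2\<^sup>T *\<^sub>v v"
  let ?c = "D' *\<^sub>v (B2 *\<^sub>v (F *\<^sub>v ?z))"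
  have a: "B1\<^sup>T *\<^sub>v ?y \<in> carrier_vec n" and c: "?c \<in> carrier_vec n"
    using v by auto
  have "x = B1\<^sup>T *\<^sub>v ?y + ?c + h"
    unfolding eq L_mult_vec[OF v] ..
  also have "\<dots> = B1\<^sup>T *\<^sub>v ?y + h + ?c"
    unfolding assoc_add_vec[OF a c hc] assoc_add_vec[OF a hc c] comm_add_vec[OF c hc] ..
  finally have "x = B1\<^sup>T *\<^sub>v ?y + h + (D' * B2 * F) *\<^sub>v ?z"
    using v by (simp only: boundary_mult_vec vec_carrier)
  then show ?thesis
    using v by (intro that[OF _ h]) auto
qed

text \<open>The three summands are pairwise orthogonal for the inner product given by
  \<open>D\<close>, so pairing their sum with any one of them leaves its squared norm.\<close>

lemma decomposition_zero:
  assumes y: "y \<in> carrier_vec m" and h: "h \<in> mat_kernel L" and z: "z \<in> carrier_vec q"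
    and sum: "B1\<^sup>T *\<^sub>v y + h + (D' * B2 * F) *\<^sub>v z = 0\<^sub>v n"
  shows "B1\<^sup>T *\<^sub>v y = 0\<^sub>v n" "h = 0\<^sub>v n" "(D' * B2 * F) *\<^sub>v z = 0\<^sub>v n"
proof -
  let ?a = "B1\<^sup>T *\<^sub>v y" and ?c = "D' *\<^sub>v (B2 *\<^sub>v (F *\<^sub>v z))"
  have hc: "h \<in> carrier_vec n" and "L *\<^sub>v h = 0\<^sub>v n"
    using mat_kernelD[OF L_carrier h] .
  then have "h \<bullet> (D *\<^sub>v (L *\<^sub>v h)) = 0"
    using scalar_prod_mat_diag[of h n "0\<^sub>v n" d] by simp
  note harm = harmonic[OF hc this]
  have a: "?a \<in> carrier_vec n" and c: "?c \<in> carrier_vec n"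
    using y z by auto
  have ha: "h \<bullet> (D *\<^sub>v ?a) = 0"
    using inner_coboundary[OF y hc] y harm by simp
  have hc0: "h \<bullet> (D *\<^sub>v ?c) = 0"
    using inner_boundary[of "F *\<^sub>v z" h] z hc harm by simp
  \<comment> \<open>Here \<open>B1_B2\<close> enters: it makes the images of coboundary and boundary
    orthogonal.\<close>
  have "B1 *\<^sub>v (B2 *\<^sub>v (F *\<^sub>v z)) = 0\<^sub>v m"
    using assoc_mult_mat_vec[OF B1 B2, of "F *\<^sub>v z"] z B1_B2 zero_mat_mult_vec[of "F *\<^sub>v z" q m] by auto
  then have ca: "?c \<bullet> (D *\<^sub>v ?a) = 0"
    using inner_coboundary[OF y c] y z by (simp add: D_D')
  have sum': "?a + h + ?c = 0\<^sub>v n"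
    using sum z by (simp add: boundary_mult_vec)
  have inner: "u \<bullet> (D *\<^sub>v ?a) + u \<bullet> (D *\<^sub>v h) + u \<bullet> (D *\<^sub>v ?c) = 0" if u: "u \<in> carrier_vec n" for u
  proof -
    have "u \<bullet> (D *\<^sub>v ?a) + u \<bullet> (D *\<^sub>v h) + u \<bullet> (D *\<^sub>v ?c) = u \<bullet> (D *\<^sub>v (?a + h + ?c))"
      using u a hc c
      by (simp add: mult_add_distrib_mat_vec[of D n n] scalar_prod_add_distrib[of _ n])
    also have "\<dots> = 0"
      using u scalar_prod_mat_diag[of u n "0\<^sub>v n" d] by (simp add: sum')
    finally show ?thesis .
  qed
  have "?a \<bullet> (D *\<^sub>v ?a) = 0"
    using inner[OF a] ha ca D_sym[OF a hc] D_sym[OF a c] by simp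
  then show "?a = 0\<^sub>v n"
    using scalar_prod_mat_diag_eq_0[OF a] d_pos by blast
  have "?c \<bullet> (D *\<^sub>v ?c) = 0"
    using inner[OF c] hc0 ca D_sym[OF c hc] by simp
  then have "?c = 0\<^sub>v n"
    using scalar_prod_mat_diag_eq_0[OF c] d_pos by blast
  then show "(D' * B2 * F) *\<^sub>v z = 0\<^sub>v n"
    using z by (simp add: boundary_mult_vec)
  have "h \<bullet> (D *\<^sub>v h) = 0"
    using inner[OF hc] ha hc0 by simp
  then show "h = 0\<^sub>v n"
    using scalar_prod_mat_diag_eq_0[OF hc] d_pos by blast
qed

text \<open>Uniqueness follows by applying \<open>decomposition_zero\<close> to the difference of
  two decompositions of \<open>x\<close>.\<close>

lemma direct_sum:
  "is_direct_sum3 n (mat_image (B1\<^sup>T)) (mat_kernel L) (mat_image (D' * B2 * F))"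
proof -
  have Bd: "D' * B2 * F \<in> carrier_mat n q"
    using B2 mult_carrier_mat mat_diag_dim by metis
  have "\<exists>!(u, v, w). u \<in> mat_image (B1\<^sup>T) \<and> v \<in> mat_kernel L \<and> w \<in> mat_image (D' * B2 * F)
      \<and> x = u + v + w" if x: "x \<in> carrier_vec n" for x
  proof -
    obtain y h z where y: "y \<in> carrier_vec m" and h: "h \<in> mat_kernel L" and z: "z \<in> carrier_vec q"
      and eq: "x = B1\<^sup>T *\<^sub>v y + h + (D' * B2 * F) *\<^sub>v z"
      using decomposition_exists[OF x] .
    have hc: "h \<in> carrier_vec n" using mat_kernelD(1)[OF L_carrier h] .
    show ?thesis
    proof (rule ex1I[of _ "(B1\<^sup>T *\<^sub>v y, h, (D' * B2 * F) *\<^sub>v z)"])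
      show "case (B1\<^sup>T *\<^sub>v y, h, (D' * B2 * F) *\<^sub>v z) of (u, v, w) \<Rightarrow>
          u \<in> mat_image (B1\<^sup>T) \<and> v \<in> mat_kernel L \<and> w \<in> mat_image (D' * B2 * F) \<and> x = u + v + w"
        using y h z eq B1 Bd by (auto simp: mat_image_def)
    next
      fix t assume t: "case t of (u, v, w) \<Rightarrow>
          u \<in> mat_image (B1\<^sup>T) \<and> v \<in> mat_kernel L \<and> w \<in> mat_image (D' * B2 * F) \<and> x = u + v + w"
      then obtain y' h' z' where y': "y' \<in> carrier_vec m" and h': "h' \<in> mat_kernel L"
        and z': "z' \<in> carrier_vec q" and t_eq: "t = (B1\<^sup>T *\<^sub>v y', h', (D' * B2 * F) *\<^sub>v z')"
        and eq': "x = B1\<^sup>T *\<^sub>v y' + h' + (D' * B2 * F) *\<^sub>v z'"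
        using B1 Bd by (auto simp: mat_image_def split: prod.splits)
      have hc': "h' \<in> carrier_vec n" using mat_kernelD(1)[OF L_carrier h'] .
      have diff_h: "h' - h \<in> mat_kernel L"
        using hc hc' mat_kernelD(2)[OF L_carrier h] mat_kernelD(2)[OF L_carrier h']
        by (intro mat_kernelI[OF L_carrier]) (auto simp: mult_minus_distrib_mat_vec[of L n n])
      have a: "B1\<^sup>T *\<^sub>v (y' - y) = B1\<^sup>T *\<^sub>v y' - B1\<^sup>T *\<^sub>v y"
        using mult_minus_distrib_mat_vec[OF B1T y' y] .
      have c: "(D' * B2 * F) *\<^sub>v (z' - z) = (D' * B2 * F) *\<^sub>v z' - (D' * B2 * F) *\<^sub>v z"
        using mult_minus_distrib_mat_vec[OF Bd z' z] .
      have car: "B1\<^sup>T *\<^sub>v y \<in> carrier_vec n" "B1\<^sup>T *\<^sub>v y' \<in> carrier_vec n"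
        "(D' * B2 * F) *\<^sub>v z \<in> carrier_vec n" "(D' * B2 * F) *\<^sub>v z' \<in> carrier_vec n"
        using y y' mult_mat_vec_carrier[OF Bd z] mult_mat_vec_carrier[OF Bd z'] by auto
      \<comment> \<open>Vectors of type \<open>real vec\<close> may have any dimension, so this
        rearrangement is checked entry by entry under carrier assumptions.\<close>
      have diff0: "u' - u + (v' - v) + (w' - w) = 0\<^sub>v n"
        if "u \<in> carrier_vec n" "u' \<in> carrier_vec n" "v \<in> carrier_vec n" "v' \<in> carrier_vec n"
          "w \<in> carrier_vec n" "w' \<in> carrier_vec n" "u + v + w = u' + v' + w'"
        for u u' v v' w w' :: "real vec"
      proof (rule eq_vecI)
        fix i assume "i < dim_vec (0\<^sub>v n :: real vec)"
        then show "(u' - u + (v' - v) + (w' - w)) $ i = (0\<^sub>v n :: real vec) $ i"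
          using that(1-6) arg_cong[OF that(7), of "\<lambda>v. v $ i"] by simp
      qed (use that in auto)
      have eq0: "p' = p" if "p' - p = 0\<^sub>v n" "p \<in> carrier_vec n" "p' \<in> carrier_vec n" for p p' :: "real vec"
      proof (rule eq_vecI)
        fix i assume "i < dim_vec p"
        then show "p' $ i = p $ i"
          using that(2,3) arg_cong[OF that(1), of "\<lambda>v. v $ i"] by simp
      qed (use that in auto)
      have "B1\<^sup>T *\<^sub>v (y' - y) + (h' - h) + (D' * B2 * F) *\<^sub>v (z' - z) = 0\<^sub>v n"
        unfolding a c using eq eq' car hc hc' by (intro diff0) auto
      from decomposition_zero[OF _ diff_h _ this]
      have "B1\<^sup>T *\<^sub>v y' - B1\<^sup>T *\<^sub>v y = 0\<^sub>v n" "h' - h = 0\<^sub>v n"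
        "(D' * B2 * F) *\<^sub>v z' - (D' * B2 * F) *\<^sub>v z = 0\<^sub>v n"
        using y y' z z' by (auto simp: a c)
      note zero = this
      show "t = (B1\<^sup>T *\<^sub>v y, h, (D' * B2 * F) *\<^sub>v z)"
        unfolding t_eq eq0[OF zero(1) car(1,2)] eq0[OF zero(2) hc hc'] eq0[OF zero(3) car(3,4)] ..
    qed
  qed
  then show ?thesis
    unfolding is_direct_sum3_def
    using mat_image_subspace[OF B1T] mat_image_subspace[OF Bd] mat_kernel_subspace[OF L_carrier] by blast
qed

end

section \<open>Application to weighted simplicial complexes\<close>

theorem theorem5:
  fixes K :: "'v set set"
    and ori :: "'v set \<Rightarrow> 'v list"
    and w :: "'v set \<Rightarrow> real"
    and sx :: "int \<Rightarrow> nat \<Rightarrow> 'v set"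
    and k :: int
  assumes "simplicial_complex K" and "K \<noteq> {}"
    and "orientation K ori"
    and "simplex_enumeration K sx"
    and "\<And>s. s \<in> K \<Longrightarrow> w s > 0"
    and "0 \<le> k" and "k \<le> complex_dim K"
  shows "is_direct_sum3 (num_simplices K k)
           (mat_image (coboundary_mat K ori sx k))
           (mat_kernel (hodge_laplacian K ori w sx k))
           (mat_image (boundary_mat K ori w sx (k + 1)))
         \<and> (\<forall>s \<in> carrier_vec (num_simplices K k).
              \<exists>s_prev \<in> carrier_vec (num_simplices K (k - 1)).
              \<exists>s_H \<in> mat_kernel (hodge_laplacian K ori w sx k).
              \<exists>s_next \<in> carrier_vec (num_simplices K (k + 1)).
                s = transpose_mat (incidence_mat K ori sx k) *\<^sub>v s_prev + s_H
                    + mat_inv (weight_mat K w sx k) * incidence_mat K ori sx (k + 1)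
                      * weight_mat K w sx (k + 1) *\<^sub>v s_next)"
proof -
  define n where "n l = num_simplices K l" for l
  let ?B = "\<lambda>l. incidence_mat K ori sx l"
  have w_pos: "0 < w (sx l i)" if "i < n l" for l i
    using assms(4,5) that by (auto simp: n_def simplex_enumeration_def simplices_def bij_betw_def)
  \<comment> \<open>The extreme orders are covered as well: for \<open>k = 0\<close> the matrix
    \<open>B\<^sub>k\<close> has no rows, and in top order \<open>B\<^sub>k\<^sub>+\<^sub>1\<close>
    has no columns.\<close>
  interpret H: weighted_pair "n k" "n (k - 1)" "n (k + 1)" "?B k" "?B (k + 1)"
    "\<lambda>i. w (sx k i)" "\<lambda>i. 1 / w (sx (k - 1) i)" "\<lambda>i. w (sx (k + 1) i)"
    using incidence_mat_mult_zero[OF assms(1,3,4)] w_pos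
    by unfold_locales (auto simp: incidence_mat_def n_def)
  have inv: "mat_inv (weight_mat K w sx l) = mat_diag (n l) (\<lambda>i. 1 / w (sx l i))" for l
    using mat_inv_weight_mat[OF assms(4,5)] by (simp add: n_def)
  have W: "weight_mat K w sx l = mat_diag (n l) (\<lambda>i. w (sx l i))" for l
    by (simp add: weight_mat_def n_def)
  have L: "hodge_laplacian K ori w sx k = H.L"
    unfolding hodge_laplacian_def H.L_def inv by (simp add: W)
  have bd: "mat_inv (weight_mat K w sx k) * ?B (k + 1) * weight_mat K w sx (k + 1) =
      mat_diag (n k) (\<lambda>i. 1 / w (sx k i)) * ?B (k + 1) * mat_diag (n (k + 1)) (\<lambda>i. w (sx (k + 1) i))"
    unfolding inv by (simp add: W)
  \<comment> \<open>The weight index \<open>k + 1 - 1\<close> reduces to \<open>k\<close>, so both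
    conjuncts concern the same boundary matrix.\<close>
  have "boundary_mat K ori w sx (k + 1) =
      mat_inv (weight_mat K w sx k) * ?B (k + 1) * weight_mat K w sx (k + 1)"
    by (simp add: boundary_mat_def)
  then show ?thesis
    unfolding coboundary_mat_def L bd n_def[symmetric]
    using H.direct_sum H.decomposition_exists by metis
qed

end
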